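(* Let $F$ be a field of characteristic different from $2$, and let $(V,b)$ be an anisotropic (symmetric) bilinear space of dimension $n\geqslant 2$ over $F$, with associated quadratic form $q(x)=b(x,x)$. Then the image of the spinor norm $\theta:\mathrm{SO}(V)\rightarrow F^\times/F^{\times 2}$ is trivial if and only if $F$ is a formally real pythagorean field and $q$ represents only one square class in $F^\times$ (i.e. all the values $q(v)$, $0\neq v\in V$, lie in a single coset of $F^{\times 2}$ in $F^\times$). In particular, in this case $q$ is similar to the quadratic form $x_1^2+\cdots+x_n^2$.
   Context: A bilinear space $(V,b)$ over $F$ is a finite-dimensional $F$-vector space $V$ with a nondegenerate symmetric bilinear form $b$; its quadratic form is $q(x)=b(x,x)$. A vector $u\in V$ is anisotropic if $q(u)\neq 0$; the space $(V,b)$ (or $q$) is anisotropic if every nonzero vector is anisotropic. $q$ represents $\lambda\in F$ if $q(v)=\lambda$ for some nonzero $v\in V$. $q$ is similar to $x_1^2+\cdots+x_n^2$ if it is isometric to $d(x_1^2+\cdots+x_n^2)$ for some $d\in F^\times$. $\mathrm{O}(V)$ is the group of isometries of $(V,b)$ and $\mathrm{SO}(V)$ (the rotation group) is its subgroup of elements of determinant $1$. For an anisotropic vector $u$, the reflection along $u$ is $\tau_u(x)=x-2\frac{b(x,u)}{q(u)}u$. By the Cartan–Dieudonné theorem every $\sigma\in\mathrm{O}(V)$ is a product $\tau_{u_1}\cdots\tau_{u_m}$ with anisotropic $u_i\in V$ and $m\leqslant n$; the spinor norm $\theta(\sigma)$ is the class of $\prod_{i=1}^m q(u_i)$ in $F^\times/F^{\times2}$,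 which is independent of the choice and number of the $u_i$. A field is formally real if $-1$ is not a sum of squares in it; a field is pythagorean if every sum of squares in it is a square. *)

theory Defs
  imports Jordan_Normal_Form.Determinant
begin

definition sum_of_squares :: "'f::field \<Rightarrow> bool" where
  "sum_of_squares a \<longleftrightarrow> (\<exists>xs. a = (\<Sum>x\<leftarrow>xs. x ^ 2))"

definition formally_real :: "'f::field itself \<Rightarrow> bool" where
  "formally_real _ \<longleftrightarrow> \<not> sum_of_squares (- 1 :: 'f)"

definition pythagorean :: "'f::field itself \<Rightarrow> bool" where
  "pythagorean _ \<longleftrightarrow> (\<forall>a::'f. sum_of_squares a \<longrightarrow> (\<exists>c. a = c ^ 2))"

text \<open>The class of a nonzero \<open>a\<close> in the group of square classes is represented by the coset
  of the nonzero squares containing it; the identity of the quotient is \<open>square_class 1\<close>.\<close>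

definition square_class :: "'f::field \<Rightarrow> 'f set" where
  "square_class a = {a * c ^ 2 | c. c \<noteq> 0}"

locale bilinear_space = vector_space scale
  for scale :: "'f::field \<Rightarrow> 'v::ab_group_add \<Rightarrow> 'v" +
  fixes b :: "'v \<Rightarrow> 'v \<Rightarrow> 'f"
  assumes finite_dimensional: "\<exists>B. finite B \<and> span B = UNIV"
    and linear_right: "Vector_Spaces.linear scale (*) (b x)"
    and symmetric: "b x y = b y x"
    and nondegenerate: "(\<forall>y. b x y = 0) \<Longrightarrow> x = 0"
begin

definition q :: "'v \<Rightarrow> 'f" where
  "q x = b x x"

definition anisotropic :: bool where
  "anisotropic \<longleftrightarrow> (\<forall>v. v \<noteq> 0 \<longrightarrow> q v \<noteq> 0)"

definition orthogonal_group :: "('v \<Rightarrow> 'v) set" where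
  "orthogonal_group =
     {\<sigma>. Vector_Spaces.linear scale scale \<sigma> \<and> bij \<sigma> \<and> (\<forall>x y. b (\<sigma> x) (\<sigma> y) = b x y)}"

definition ordered_basis :: "'v list \<Rightarrow> bool" where
  "ordered_basis bs \<longleftrightarrow> distinct bs \<and> independent (set bs) \<and> span (set bs) = UNIV"

text \<open>The \<open>j\<close>-th column holds the coordinates of the image of the \<open>j\<close>-th basis vector.\<close>

definition matrix_wrt :: "'v list \<Rightarrow> ('v \<Rightarrow> 'v) \<Rightarrow> 'f mat" where
  "matrix_wrt bs f =
     mat (length bs) (length bs) (\<lambda>(i, j). representation (set bs) (f (bs ! j)) (bs ! i))"

text \<open>The determinant of an endomorphism does not depend on the ordered basis chosen here.\<close>

definition endo_det :: "('v \<Rightarrow> 'v) \<Rightarrow> 'f" where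
  "endo_det f = det (matrix_wrt (SOME bs. ordered_basis bs) f)"

definition special_orthogonal_group :: "('v \<Rightarrow> 'v) set" where
  "special_orthogonal_group = {\<sigma> \<in> orthogonal_group. endo_det \<sigma> = 1}"

definition reflection :: "'v \<Rightarrow> 'v \<Rightarrow> 'v" where
  "reflection u x = x - scale (2 * b x u / q u) u"

definition reflection_factorization :: "('v \<Rightarrow> 'v) \<Rightarrow> 'v list \<Rightarrow> bool" where
  "reflection_factorization \<sigma> us \<longleftrightarrow>
     (\<forall>u\<in>set us. q u \<noteq> 0) \<and> \<sigma> = foldr (\<circ>) (map reflection us) id"

text \<open>In characteristic different from 2, every isometry is a product of reflections
  (Cartan--Dieudonne) and the square class of \<open>q u\<^sub>1 * \<dots> * q u\<^sub>m\<close> does not depend on the choice or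
  the number of the anisotropic vectors \<open>u\<^sub>i\<close>, so the class described below exists and is unique
  for \<open>\<sigma>\<close> in the orthogonal group. The empty factorization of \<open>id\<close> gives the class of 1.\<close>

definition spinor_norm :: "('v \<Rightarrow> 'v) \<Rightarrow> 'f set" where
  "spinor_norm \<sigma> =
     (THE C. \<exists>us. reflection_factorization \<sigma> us \<and> C = square_class (\<Prod>u\<leftarrow>us. q u))"

definition represents :: "'f \<Rightarrow> bool" where
  "represents a \<longleftrightarrow> (\<exists>v. v \<noteq> 0 \<and> q v = a)"

definition represents_only_one_square_class :: bool where
  "represents_only_one_square_class \<longleftrightarrow> (\<exists>d. d \<noteq> 0 \<and> (\<forall>a. represents a \<longrightarrow> a \<in> square_class d))"

text \<open>The form \<open>q\<close> is isometric to \<open>d * (x\<^sub>1\<^sup>2 + \<dots> + x\<^sub>n\<^sup>2)\<close> on the space of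
  \<open>n\<close>-dimensional column vectors for some nonzero \<open>d\<close>.\<close>

definition similar_to_sum_of_squares :: "nat \<Rightarrow> bool" where
  "similar_to_sum_of_squares n \<longleftrightarrow>
     (\<exists>d \<phi>. d \<noteq> 0 \<and> bij_betw \<phi> UNIV (carrier_vec n) \<and>
        (\<forall>x y. \<phi> (x + y) = \<phi> x + \<phi> y) \<and> (\<forall>c x. \<phi> (scale c x) = c \<cdot>\<^sub>v \<phi> x) \<and>
        (\<forall>x. q x = d * (\<Sum>i<n. (\<phi> x $ i) ^ 2)))"

end

end

theory Submission
  imports Defs
begin

text \<open>The spinor norm of \<open>\<tau>\<^sub>u \<circ> \<tau>\<^sub>v\<close> is the class of \<open>q u * q v\<close>, so a trivial image forces all
  values of \<open>q\<close> into one square class \<open>d\<close>; conversely, a rotation is a product of an even number of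
  reflections, so its spinor norm is then an even power of \<open>d\<close>. If there is only one class,
  Gram--Schmidt gives an orthogonal basis of vectors of value \<open>d\<close>; two of them span a plane on which
  \<open>q\<close> is \<open>d (x\<^sup>2 + y\<^sup>2)\<close>, so every nontrivial sum of two squares is a nonzero square, and the
  field is formally real and pythagorean.

  That the spinor norm is well defined is shown without the Clifford algebra. Fix a vector \<open>e\<close>.
  Every product \<open>\<sigma>\<close> of reflections can be rewritten as \<open>\<tau>\<^bsub>\<sigma> e - e\<^esub>\<close> followed by reflections along vectors
  orthogonal to \<open>e\<close> without changing the square class, because for \<open>a = x - e\<close> and
  \<open>v = \<tau>\<^sub>u x - e\<close> the vectors \<open>a\<close>, \<open>u\<close>, \<open>v\<close> lie in one plane and \<open>\<tau>\<^sub>u \<circ> \<tau>\<^sub>a = \<tau>\<^sub>v \<circ> \<tau>\<^sub>w\<close> for some \<open>w\<close>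
  orthogonal to \<open>e\<close>. Applied to a product equal to the identity, with \<open>e\<close> running through a basis,
  this removes all reflections.\<close>

section \<open>A determinant identity and square classes\<close>

text \<open>Sylvester's identity: the block matrix with rows \<open>1, A\<close> and
  \<open>B, 1\<close> factors both as \<open>?L * ?U\<close> and as \<open>?U' * ?L\<close>, and
  every factor is block triangular. With \<open>m = 1\<close> it reduces the determinant of a
  reflection to a scalar.\<close>

lemma det_one_minus_mult_commute:
  fixes A B :: "'a::idom mat"
  assumes A: "A \<in> carrier_mat n m" and B: "B \<in> carrier_mat m n"
  shows "det (1\<^sub>m n - A * B) = det (1\<^sub>m m - B * A)"
proof -
  let ?L = "four_block_mat (1\<^sub>m n) (0\<^sub>m n m) B (1\<^sub>m m)"
  let ?U = "four_block_mat (1\<^sub>m n) A (0\<^sub>m m n) (1\<^sub>m m - B * A)"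
  let ?U' = "four_block_mat (1\<^sub>m n - A * B) A (0\<^sub>m m n) (1\<^sub>m m)"
  have BA: "1\<^sub>m m - B * A \<in> carrier_mat m m" and AB: "1\<^sub>m n - A * B \<in> carrier_mat n n"
    using A B by auto
  have "B * A + (1\<^sub>m m - B * A) = 1\<^sub>m m" "1\<^sub>m n - A * B + A * B = 1\<^sub>m n"
    using A B by (auto intro!: eq_matI)
  then have 1: "?L * ?U = four_block_mat (1\<^sub>m n) A B (1\<^sub>m m)"
    and 2: "?U' * ?L = four_block_mat (1\<^sub>m n) A B (1\<^sub>m m)"
    using A B BA AB by (simp_all add: mult_four_block_mat[of _ n n _ m _ m _ _ n _ m])
  have L: "?L \<in> carrier_mat (n + m) (n + m)" and U: "?U \<in> carrier_mat (n + m) (n + m)"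
    and U': "?U' \<in> carrier_mat (n + m) (n + m)"
    using AB BA by (auto intro!: four_block_carrier_mat)
  have "det ?L = 1"
    using B by (subst det_four_block_mat_upper_right_zero[of _ n _ m]) auto
  moreover have "det ?U = det (1\<^sub>m m - B * A)"
    using A BA by (subst det_four_block_mat_lower_left_zero[of _ n _ m]) auto
  moreover have "det ?U' = det (1\<^sub>m n - A * B)"
    using A AB by (subst det_four_block_mat_lower_left_zero[of _ n _ m]) auto
  ultimately show ?thesis
    using det_mult[OF L U] det_mult[OF U' L] 1 2 by simp
qed

lemma square_class_eq_iff:
  "square_class a = square_class c \<longleftrightarrow> (\<exists>r. r \<noteq> 0 \<and> a = c * r ^ 2)"
proof
  assume "square_class a = square_class c"
  moreover have "a \<in> square_class a"
    unfolding square_class_def by (intro CollectI exI[of _ 1]) simp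
  ultimately show "\<exists>r. r \<noteq> 0 \<and> a = c * r ^ 2"
    unfolding square_class_def by blast
next
  assume "\<exists>r. r \<noteq> 0 \<and> a = c * r ^ 2"
  then obtain r where r: "r \<noteq> 0" "a = c * r ^ 2"
    by blast
  have "a * s ^ 2 = c * (r * s) ^ 2" "c * s ^ 2 = a * (s / r) ^ 2" for s
    using r by (simp_all add: power_mult_distrib power_divide)
  then show "square_class a = square_class c"
    unfolding square_class_def using r(1) by fastforce
qed

lemma square_class_mult_cong:
  assumes "square_class a = square_class a'" "square_class c = square_class c'"
  shows "square_class (a * c) = square_class (a' * c')"
proof -
  obtain r s where "r \<noteq> 0" "a = a' * r ^ 2" "s \<noteq> 0" "c = c' * s ^ 2"
    using assms unfolding square_class_eq_iff by blast
  then show ?thesis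
    unfolding square_class_eq_iff
    by (intro exI[of _ "r * s"]) (simp add: power_mult_distrib ac_simps)
qed

section \<open>The bilinear form, reflections and their products\<close>

context bilinear_space
begin

lemma b_add_right: "b x (y + z) = b x y + b x z"
  and b_scale_right: "b x (scale c y) = c * b x y"
  using linear_right[of x] unfolding Vector_Spaces.linear_iff by auto

lemma b_add_left: "b (y + z) x = b y x + b z x"
  and b_scale_left: "b (scale c y) x = c * b y x"
  using b_add_right[of x y z] b_scale_right[of x c y] by (simp_all add: symmetric[of _ x])

lemma b_zero_right [simp]: "b x 0 = 0"
  using b_scale_right[of x 0 0] by simp

lemma b_zero_left [simp]: "b 0 x = 0"
  by (simp add: symmetric[of 0])

lemma b_diff_right: "b x (y - z) = b x y - b x z"
  using b_add_right[of x "y - z" z] by simp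

lemma b_diff_left: "b (y - z) x = b y x - b z x"
  by (simp add: symmetric[of _ x] b_diff_right)

lemma b_sum_right: "b x (\<Sum>i\<in>I. f i) = (\<Sum>i\<in>I. b x (f i))"
  by (induction I rule: infinite_finite_induct) (simp_all add: b_add_right)

lemmas b_simps = b_add_right b_scale_right b_add_left b_scale_left b_diff_right b_diff_left

lemma b_eq_0_span:
  assumes "x \<in> span S" "\<And>s. s \<in> S \<Longrightarrow> b s y = 0"
  shows "b x y = 0"
  using assms(1) by (induction rule: span_induct_alt) (simp_all add: b_simps assms(2))

lemma q_zero [simp]: "q 0 = 0"
  by (simp add: q_def)

lemma q_scale: "q (scale c x) = c ^ 2 * q x"
  by (simp add: q_def b_simps power2_eq_square)

lemma reflection_zero [simp]: "reflection 0 = id"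
  by (simp add: reflection_def fun_eq_iff)

lemma reflection_scale:
  assumes "c \<noteq> 0"
  shows "reflection (scale c u) = reflection u"
  using assms by (simp add: reflection_def fun_eq_iff q_scale b_simps power2_eq_square)

lemma reflection_linear: "Vector_Spaces.linear scale scale (reflection u)"
  unfolding Vector_Spaces.linear_iff reflection_def
  by (auto simp: b_simps algebra_simps add_divide_distrib vector_space_axioms)

lemma b_reflection:
  assumes "q u \<noteq> 0"
  shows "b (reflection u x) (reflection u y) = b x y"
  using assms unfolding reflection_def q_def
  by (simp add: b_simps symmetric[of u x] symmetric[of u y] field_simps)

lemma reflection_involution:
  assumes "q u \<noteq> 0"
  shows "reflection u (reflection u x) = x"
  using assms unfolding reflection_def
  by (simp add: b_simps q_def[symmetric] diff_divide_distrib scale_left_diff_distrib)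

lemma reflection_fixes:
  assumes "b u x = 0"
  shows "reflection u x = x"
  using assms by (simp add: reflection_def symmetric[of x u])

text \<open>The product occurring in \<open>reflection_factorization\<close>, separated from the
  condition on the vectors. The head of the list acts last, so appending lists composes the
  maps.\<close>

definition reflections :: "'v list \<Rightarrow> 'v \<Rightarrow> 'v" where
  "reflections us = foldr (\<circ>) (map reflection us) id"

lemma reflections_Nil [simp]: "reflections [] = id"
  and reflections_Cons [simp]: "reflections (u # us) = reflection u \<circ> reflections us"
  by (simp_all add: reflections_def)

lemma reflections_append: "reflections (us @ vs) = reflections us \<circ> reflections vs"
  by (induction us) (simp_all add: comp_assoc)

text \<open>Each factor is an involution, so the product cancels from the middle outwards: reversing
  a list inverts its product.\<close>

lemma reflections_rev:
  assumes "\<forall>u\<in>set us. q u \<noteq> 0"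
  shows "reflections us \<circ> reflections (rev us) = id"
  using assms
  by (induction us) (simp_all add: reflections_append fun_eq_iff reflection_involution)

lemma reflections_linear: "Vector_Spaces.linear scale scale (reflections us)"
proof (induction us)
  case Nil
  then show ?case
    using linear_id by (simp add: id_def)
next
  case (Cons u us)
  then show ?case
    unfolding reflections_Cons by (rule Vector_Spaces.linear_compose[OF _ reflection_linear])
qed

lemma b_reflections:
  assumes "\<forall>u\<in>set us. q u \<noteq> 0"
  shows "b (reflections us x) (reflections us y) = b x y"
  using assms by (induction us arbitrary: x y) (simp_all add: b_reflection)

lemma reflections_fixes:
  assumes "\<forall>u\<in>set us. b u x = 0"
  shows "reflections us x = x"
  using assms by (induction us) (simp_all add: reflection_fixes)

lemma reflections_in_orthogonal_group:
  assumes "\<forall>u\<in>set us. q u \<noteq> 0"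
  shows "reflections us \<in> orthogonal_group"
proof -
  have "reflections (rev us) \<circ> reflections us = id"
    using reflections_rev[of "rev us"] assms by simp
  then have "bij (reflections us)"
    using reflections_rev[OF assms] o_bij by blast
  then show ?thesis
    by (simp add: orthogonal_group_def reflections_linear b_reflections assms)
qed

lemma reflection_factorization_iff:
  "reflection_factorization \<sigma> us \<longleftrightarrow> (\<forall>u\<in>set us. q u \<noteq> 0) \<and> \<sigma> = reflections us"
  by (simp add: reflection_factorization_def reflections_def)

section \<open>Bases and the determinant of a product of reflections\<close>

text \<open>Ensures that the choice operator in \<open>endo_det\<close> returns an actual
  basis.\<close>

lemma ordered_basis_exists: "\<exists>bs. ordered_basis bs"
proof -
  obtain B where B: "finite B" "span B = UNIV"
    using finite_dimensional by blast
  obtain C where C: "independent C" "UNIV \<subseteq> span C"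
    using basis_exists[of UNIV] by blast
  have "finite C"
    using independent_span_bound[of B C] B C by auto
  then obtain bs where "set bs = C" "distinct bs"
    using finite_distinct_list by blast
  then show ?thesis
    unfolding ordered_basis_def using C by blast
qed

lemma sum_ordered_basis:
  assumes "ordered_basis bs"
  shows "(\<Sum>k<length bs. scale (representation (set bs) x (bs ! k)) (bs ! k)) = x"
proof -
  have "(\<Sum>v\<in>set bs. scale (representation (set bs) x v) v) = x"
    using assms by (intro sum_representation_eq) (auto simp: ordered_basis_def)
  moreover have "bij_betw ((!) bs) {..<length bs} (set bs)"
    using assms by (intro bij_betw_nth) (auto simp: ordered_basis_def)
  ultimately show ?thesis
    by (simp add: sum.reindex_bij_betw[of "(!) bs" _ _ "\<lambda>v. scale (representation (set bs) x v) v"])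
qed

lemma representation_ordered_basis:
  assumes "ordered_basis bs" "i < length bs" "j < length bs"
  shows "representation (set bs) (bs ! j) (bs ! i) = (if i = j then 1 else 0)"
  using assms by (simp add: ordered_basis_def representation_basis nth_eq_iff_index_eq)

lemma matrix_wrt_compose:
  assumes bs: "ordered_basis bs" and f: "Vector_Spaces.linear scale scale f"
  shows "matrix_wrt bs (f \<circ> g) = matrix_wrt bs f * matrix_wrt bs g"
proof (rule eq_matI)
  fix i j
  assume "i < dim_row (matrix_wrt bs f * matrix_wrt bs g)"
    "j < dim_col (matrix_wrt bs f * matrix_wrt bs g)"
  then have ij: "i < length bs" "j < length bs"
    by (simp_all add: matrix_wrt_def)
  interpret f: Vector_Spaces.linear scale scale f
    by (rule f)
  have ind: "independent (set bs)" and sp: "x \<in> span (set bs)" for x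
    using bs by (auto simp: ordered_basis_def)
  let ?r = "representation (set bs)"
  have "f (g (bs ! j)) = (\<Sum>k<length bs. scale (?r (g (bs ! j)) (bs ! k)) (f (bs ! k)))"
    by (subst sum_ordered_basis[OF bs, symmetric]) (simp add: f.sum f.scale)
  then have "?r (f (g (bs ! j))) (bs ! i)
      = (\<Sum>k<length bs. ?r (g (bs ! j)) (bs ! k) * ?r (f (bs ! k)) (bs ! i))"
    by (simp add: representation_sum[OF ind sp] representation_scale[OF ind sp])
  then show "matrix_wrt bs (f \<circ> g) $$ (i, j) = (matrix_wrt bs f * matrix_wrt bs g) $$ (i, j)"
    using ij by (simp add: matrix_wrt_def scalar_prod_def mult.commute lessThan_atLeast0)
qed (simp_all add: matrix_wrt_def)

text \<open>A reflection is a rank one perturbation of the identity: \<open>A\<close> is the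
  coordinate column of \<open>u\<close> and \<open>B\<close> is the row of the functional
  \<open>2 * b x u / q u\<close> in \<open>x\<close>. The determinant is therefore
  \<open>1 - B * A\<close>, and \<open>B * A\<close> is the value 2 of this functional at
  \<open>u\<close>.\<close>

lemma det_matrix_wrt_reflection:
  assumes bs: "ordered_basis bs" and u: "q u \<noteq> 0"
  shows "det (matrix_wrt bs (reflection u)) = -1"
proof -
  let ?n = "length bs" and ?r = "representation (set bs)"
  define A where "A = mat ?n 1 (\<lambda>(i, j). ?r u (bs ! i))"
  define B where "B = mat 1 ?n (\<lambda>(i, j). 2 * b (bs ! j) u / q u)"
  have A: "A \<in> carrier_mat ?n 1" and B: "B \<in> carrier_mat 1 ?n"
    by (simp_all add: A_def B_def)
  have ind: "independent (set bs)" and sp: "x \<in> span (set bs)" for x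
    using bs by (auto simp: ordered_basis_def)
  have "matrix_wrt bs (reflection u) = 1\<^sub>m ?n - A * B"
    by (rule eq_matI)
      (simp_all add: matrix_wrt_def A_def B_def reflection_def scalar_prod_def
        representation_diff[OF ind sp sp] representation_scale[OF ind sp]
        representation_ordered_basis[OF bs])
  then have "det (matrix_wrt bs (reflection u)) = det (1\<^sub>m 1 - B * A)"
    using det_one_minus_mult_commute[OF A B] by simp
  also have "\<dots> = 1 - (\<Sum>k<?n. 2 * b (bs ! k) u / q u * ?r u (bs ! k))"
    using A B by (subst det_single) (auto simp: A_def B_def scalar_prod_def lessThan_atLeast0)
  also have "(\<Sum>k<?n. 2 * b (bs ! k) u / q u * ?r u (bs ! k))
      = 2 / q u * b u (\<Sum>k<?n. scale (?r u (bs ! k)) (bs ! k))"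
    by (simp add: b_sum_right b_simps sum_distrib_left symmetric[of u] mult_ac)
  also have "\<dots> = 2"
    using u by (simp add: sum_ordered_basis[OF bs] q_def)
  finally show ?thesis
    by simp
qed

lemma endo_det_reflections:
  assumes "\<forall>u\<in>set us. q u \<noteq> 0"
  shows "endo_det (reflections us) = (-1) ^ length us"
proof -
  define bs where "bs = (SOME bs. ordered_basis bs)"
  have bs: "ordered_basis bs"
    unfolding bs_def using ordered_basis_exists by (rule someI_ex)
  have M: "matrix_wrt bs f \<in> carrier_mat (length bs) (length bs)" for f
    by (simp add: matrix_wrt_def)
  have "det (matrix_wrt bs (reflections us)) = (-1) ^ length us"
    using assms
  proof (induction us)
    case Nil
    have "matrix_wrt bs (\<lambda>x. x) = 1\<^sub>m (length bs)"
      by (rule eq_matI) (simp_all add: matrix_wrt_def representation_ordered_basis[OF bs])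
    then show ?case
      by (simp add: id_def)
  next
    case (Cons u us)
    then show ?case
      unfolding reflections_Cons matrix_wrt_compose[OF bs reflection_linear] det_mult[OF M M]
      by (simp add: det_matrix_wrt_reflection[OF bs])
  qed
  then show ?thesis
    by (simp add: endo_det_def bs_def)
qed

end

section \<open>Exchange of reflections in an anisotropic space\<close>

locale anisotropic_bilinear_space = bilinear_space scale b
  for scale :: "'f::field \<Rightarrow> 'v::ab_group_add \<Rightarrow> 'v" and b +
  assumes char_not_2: "CHAR('f) \<noteq> 2"
    and anisotropic: anisotropic
begin

text \<open>If 2 vanished, the characteristic would divide the prime 2 without being 1, hence would
  be 2.\<close>

lemma two_neq_0 [simp]: "(2::'f) \<noteq> 0"
proof
  assume "(2::'f) = 0"
  then have "CHAR('f) dvd 2"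
    using of_nat_eq_0_iff_char_dvd[where 'a = 'f, of 2] by simp
  then show False
    using char_not_2 CHAR_not_1[where 'a = 'f] prime_nat_iff[of 2] two_is_prime_nat by auto
qed

lemma four_neq_0 [simp]: "(4::'f) \<noteq> 0"
  using mult_eq_0_iff[of 2 "2::'f"] by simp

lemma q_eq_0_iff [simp]: "q x = 0 \<longleftrightarrow> x = 0"
  using anisotropic by (auto simp: anisotropic_def)

text \<open>Up to a scalar, \<open>w\<close> is the product \<open>v u a\<close> in the Clifford algebra of the plane spanned by
  \<open>a\<close> and \<open>u\<close>, which is again a vector.\<close>

lemma reflection_mult_in_plane:
  assumes u: "u \<noteq> 0" and norm: "q x = q e"
    and a: "a = x - e" "a \<noteq> 0" and v: "v = reflection u x - e" "v \<noteq> 0"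
    and w: "w = scale (b u e) a - scale (b a e) u"
  shows "b w e = 0" "4 * q w = q a * q u * q v"
    "reflection u \<circ> reflection a = reflection v \<circ> reflection w"
proof -
  \<comment> \<open>Here \<open>c\<close> is the coefficient with \<open>v = a - scale c u\<close>,
    and \<open>m\<close> equals \<open>b v e\<close>. Since \<open>x\<close> and its reflection both
    have the value \<open>q e\<close>, this gives \<open>q a = - 2 * \<alpha>\<close> and
    \<open>q v = - 2 * m\<close>.\<close>
  define \<alpha> \<beta> g k c m where "\<alpha> = b a e" and "\<beta> = b u e" and "g = b a u" and "k = q u"
    and "c = 2 * b x u / q u" and "m = \<alpha> - c * \<beta>"
  have k0: "k \<noteq> 0"
    using u by (simp add: k_def)
  have qa: "q a = - 2 * \<alpha>"
    using norm by (simp add: a(1) \<alpha>_def q_def b_simps symmetric[of e x])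
  have "b x u = g + \<beta>"
    by (simp add: g_def \<beta>_def a(1) b_simps symmetric[of e u])
  \<comment> \<open>The relation between the parameters on which the polynomial identities below
    rest.\<close>
  then have g: "2 * g = c * k - 2 * \<beta>"
    using k0 by (simp add: c_def k_def field_simps)
  have v_eq: "v = a - scale c u"
    by (simp add: v(1) a(1) c_def reflection_def)
  have ua: "b u a = g"
    by (simp add: g_def symmetric)
  have bb: "b a a = - 2 * \<alpha>" "b u u = k" "b a u = g" "b u a = g" "b u e = \<beta>" "b a e = \<alpha>"
    using qa ua by (simp_all add: q_def k_def g_def \<alpha>_def \<beta>_def)
  have w_eq: "w = scale \<beta> a - scale \<alpha> u"
    by (simp add: w \<alpha>_def \<beta>_def)
  have "q v = - 2 * \<alpha> - c * g - c * (g - c * k)"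
    by (simp add: q_def v_eq b_simps bb)
  also have "\<dots> = - 2 * m"
    unfolding m_def using g by Groebner_Basis.algebra
  finally have qv: "q v = - 2 * m" .
  have "q w = \<beta> * (- (\<beta> * (2 * \<alpha>)) - \<alpha> * g) - \<alpha> * (\<beta> * g - \<alpha> * k)"
    by (simp add: q_def w_eq b_simps bb)
  also have "\<dots> = \<alpha> * k * m"
    unfolding m_def using g by Groebner_Basis.algebra
  finally have qw: "q w = \<alpha> * k * m" .
  show "b w e = 0"
    by (simp add: w_eq b_simps bb)
  show "4 * q w = q a * q u * q v"
    by (simp add: qa qv qw k_def)
  have \<alpha>0: "\<alpha> \<noteq> 0" and m0: "m \<noteq> 0"
    using qa qv a(2) v(2) q_eq_0_iff[of a] q_eq_0_iff[of v] by auto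
  have "b w v = - (\<beta> * (2 * \<alpha>)) - \<alpha> * g - c * (\<beta> * g - \<alpha> * k)"
    by (simp add: w_eq v_eq b_simps bb)
  also have "\<dots> = m * g"
    unfolding m_def using g by Groebner_Basis.algebra
  finally have wv: "b w v = m * g" .
  show "reflection u \<circ> reflection a = reflection v \<circ> reflection w"
  proof
    fix z
    \<comment> \<open>The left side subtracts from \<open>z\<close> multiples \<open>p'\<close> of
      \<open>a\<close> and \<open>r'\<close> of \<open>u\<close>, the right side multiples
      \<open>p\<close> of \<open>w\<close> and \<open>r\<close> of \<open>v\<close>. Writing
      \<open>w\<close> and \<open>v\<close> in terms of \<open>a\<close> and \<open>u\<close>, it
      suffices to show \<open>p' = p * \<beta> + r\<close> and
      \<open>r' = - p * \<alpha> - r * c\<close>.\<close>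
    define A U where "A = b z a" and "U = b z u"
    define W where "W = \<beta> * A - \<alpha> * U"
    have zw: "b z w = W" and zv: "b z v = A - c * U"
      by (simp_all add: w_eq v_eq W_def A_def U_def b_simps)
    define p r where "p = 2 * W / (\<alpha> * k * m)" and "r = - (A - c * U - p * (m * g)) / m"
    have p: "2 * b z w / q w = p"
      by (simp add: p_def zw qw)
    have "2 * b (reflection w z) v / q v = 2 * (A - c * U - p * (m * g)) / (- 2 * m)"
      by (simp add: reflection_def p b_simps zv wv qv)
    also have "\<dots> = r"
      using m0 by (simp add: r_def field_simps)
    finally have r: "2 * b (reflection w z) v / q v = r" .
    define p' r' where "p' = - A / \<alpha>" and "r' = 2 * (U - p' * g) / k"
    have p': "2 * b z a / q a = p'"
      by (simp add: p'_def A_def qa)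
    have r': "2 * b (reflection a z) u / q u = r'"
      by (simp add: reflection_def p' b_simps r'_def U_def bb(3) k_def)
    have g': "g = c * k / 2 - \<beta>"
      using g by (simp add: field_simps)
    have "p' = p * \<beta> + r"
      using \<alpha>0 m0 k0 unfolding p'_def p_def r_def W_def
      by (simp add: divide_simps g') (unfold m_def, Groebner_Basis.algebra)
    moreover have "r' = - p * \<alpha> - r * c"
      using \<alpha>0 m0 k0 unfolding r'_def p'_def p_def r_def W_def
      by (simp add: divide_simps g') (unfold m_def, Groebner_Basis.algebra)
    ultimately have "z - scale p' a - scale r' u
        = z - scale p (scale \<beta> a - scale \<alpha> u) - scale r (a - scale c u)"
      by (simp add: scale_left_distrib scale_left_diff_distrib scale_right_diff_distrib)
    moreover have "(reflection u \<circ> reflection a) z = z - scale p' a - scale r' u"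
      by (simp only: comp_apply reflection_def[of u] r') (simp only: reflection_def p')
    moreover have "(reflection v \<circ> reflection w) z
        = z - scale p (scale \<beta> a - scale \<alpha> u) - scale r (a - scale c u)"
      by (simp only: comp_apply reflection_def[of v] r)
        (simp only: reflection_def p, simp only: w_eq v_eq)
    ultimately show "(reflection u \<circ> reflection a) z = (reflection v \<circ> reflection w) z"
      by simp
  qed
qed

text \<open>Since \<open>q 0 = 0\<close>, the reflection along 0 is the identity; giving it spinor norm 1 avoids
  case distinctions.\<close>

definition reflection_norm :: "'v \<Rightarrow> 'f" where
  "reflection_norm u = (if u = 0 then 1 else q u)"

text \<open>One exchange step. The vectors \<open>a\<close> and \<open>v\<close> differ by a
  multiple of \<open>u\<close>; if neither vanishes, the plane identity supplies a single
  \<open>w\<close>, if exactly one vanishes, \<open>ws\<close> is empty, and if both vanish,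
  \<open>u\<close> is itself orthogonal to \<open>e\<close>. The clause about \<open>s\<close>
  preserves the orthogonality gained for earlier choices of \<open>e\<close>.\<close>

lemma reflection_exchange:
  assumes u: "u \<noteq> 0" and norm: "q x = q e"
  obtains ws where "0 \<notin> set ws" "\<forall>w\<in>set ws. b w e = 0"
    "\<And>s. b (x - e) s = 0 \<Longrightarrow> b u s = 0 \<Longrightarrow> \<forall>w\<in>set ws. b w s = 0"
    "reflection u \<circ> reflection (x - e) = reflection (reflection u x - e) \<circ> reflections ws"
    "square_class (q u * reflection_norm (x - e))
      = square_class (reflection_norm (reflection u x - e) * (\<Prod>w\<leftarrow>ws. q w))"
proof -
  define a v where "a = x - e" and "v = reflection u x - e"
  define c where "c = 2 * b x u / q u"
  have v_eq: "v = a - scale c u"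
    by (simp add: v_def a_def c_def reflection_def)
  have sq: "square_class (q (scale r u)) = square_class (q u)" if "r \<noteq> 0" for r
    unfolding square_class_eq_iff using that by (intro exI[of _ r]) (simp add: q_scale mult.commute)
  have q_q: "square_class (q u * q u) = square_class 1"
    unfolding square_class_eq_iff using u by (intro exI[of _ "q u"]) (simp add: power2_eq_square)
  consider "a = 0" "v = 0" | "a = 0" "v \<noteq> 0" | "a \<noteq> 0" "v = 0" | "a \<noteq> 0" "v \<noteq> 0"
    by blast
  then show thesis
  proof cases
    case 1
    then have "c = 0" "x = e"
      using u v_eq a_def by auto
    then have "b u e = 0"
      using u by (simp add: c_def symmetric[of e u])
    then show thesis
      using 1 u unfolding a_def v_def
      by (intro that[of "[u]"]) (simp_all add: reflection_norm_def)
  next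
    case 2
    then have "v = scale (- c) u" "c \<noteq> 0"
      using v_eq by auto
    then have "reflection v = reflection u" "square_class (q v) = square_class (q u)"
      using reflection_scale[of "- c" u] sq[of "- c"] by simp_all
    then show thesis
      using 2 unfolding a_def v_def
      by (intro that[of "[]"]) (simp_all add: reflection_norm_def)
  next
    case 3
    then have a: "a = scale c u" "c \<noteq> 0"
      using v_eq by auto
    then have "reflection a = reflection u"
      using reflection_scale by simp
    then have "reflection u \<circ> reflection a = id"
      using u by (simp add: fun_eq_iff reflection_involution)
    moreover have "square_class (q u * q a) = square_class 1"
      using square_class_mult_cong[OF refl sq[OF a(2)], of "q u"] q_q a(1) by simp
    ultimately show thesis
      using 3 unfolding a_def v_def
      by (intro that[of "[]"]) (simp_all add: reflection_norm_def)
  next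
    case 4
    define w where "w = scale (b u e) a - scale (b a e) u"
    note plane = reflection_mult_in_plane[OF u norm a_def 4(1) v_def 4(2) w_def]
    have w0: "w \<noteq> 0"
      using plane(2) u 4 by auto
    have "4 * (q v * q w) = q v * (4 * q w)"
      by simp
    also have "\<dots> = q u * q a * q v ^ 2"
      unfolding plane(2) by (simp add: power2_eq_square)
    finally have "4 * (q v * q w) = q u * q a * q v ^ 2" .
    then have "q v * q w = q u * q a * (q v / 2) ^ 2"
      by (simp add: power_divide field_simps)
    then have "square_class (q v * q w) = square_class (q u * q a)"
      unfolding square_class_eq_iff using 4 by (intro exI[of _ "q v / 2"]) simp
    moreover have "b w s = 0" if "b a s = 0" "b u s = 0" for s
      using that by (simp add: w_def b_simps)
    ultimately show thesis
      using 4 w0 plane(1,3) unfolding a_def v_def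
      by (intro that[of "[w]"]) (simp_all add: reflection_norm_def)
  qed
qed

text \<open>Gathers all movement of \<open>e\<close> into one leftmost reflection. By induction the
  tail already has this form, and \<open>reflection_exchange\<close> moves the new head past its
  front factor. The set \<open>S\<close> holds vectors treated before and grows by
  \<open>e\<close>.\<close>

lemma reflections_exchange:
  assumes "0 \<notin> set us" "\<forall>u\<in>set us. \<forall>s\<in>S. b u s = 0"
  shows "\<exists>ws. 0 \<notin> set ws \<and> (\<forall>w\<in>set ws. \<forall>s\<in>insert e S. b w s = 0) \<and>
    reflections us = reflection (reflections us e - e) \<circ> reflections ws \<and>
    square_class (\<Prod>u\<leftarrow>us. q u)
      = square_class (reflection_norm (reflections us e - e) * (\<Prod>w\<leftarrow>ws. q w))"
  using assms
proof (induction us)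
  case Nil
  show ?case
    \<comment> \<open>The front factor is the reflection along \<open>e - e = 0\<close>, the
      identity of norm 1.\<close>
    by (rule exI[of _ "[]"]) (simp add: reflection_norm_def)
next
  case (Cons u us)
  let ?x = "reflections us e"
  have "\<exists>ws. 0 \<notin> set ws \<and> (\<forall>w\<in>set ws. \<forall>s\<in>insert e S. b w s = 0) \<and>
    reflections us = reflection (?x - e) \<circ> reflections ws \<and>
    square_class (\<Prod>u\<leftarrow>us. q u) = square_class (reflection_norm (?x - e) * (\<Prod>w\<leftarrow>ws. q w))"
    using Cons.prems by (intro Cons.IH) simp_all
  then obtain ws where ws: "0 \<notin> set ws" "\<forall>w\<in>set ws. \<forall>s\<in>insert e S. b w s = 0"
    "reflections us = reflection (?x - e) \<circ> reflections ws"
    "square_class (\<Prod>u\<leftarrow>us. q u) = square_class (reflection_norm (?x - e) * (\<Prod>w\<leftarrow>ws. q w))"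
    by blast
  have u: "u \<noteq> 0" and us: "\<forall>u\<in>set us. q u \<noteq> 0" and S: "\<forall>u\<in>set us. \<forall>s\<in>S. b u s = 0"
    "\<forall>s\<in>S. b u s = 0"
    using Cons.prems by auto
  have "q ?x = q e"
    unfolding q_def by (rule b_reflections[OF us])
  from reflection_exchange[OF u this] obtain ws' where ws': "0 \<notin> set ws'" "\<forall>w\<in>set ws'. b w e = 0"
    "\<And>s. b (?x - e) s = 0 \<Longrightarrow> b u s = 0 \<Longrightarrow> \<forall>w\<in>set ws'. b w s = 0"
    "reflection u \<circ> reflection (?x - e) = reflection (reflection u ?x - e) \<circ> reflections ws'"
    "square_class (q u * reflection_norm (?x - e))
      = square_class (reflection_norm (reflection u ?x - e) * (\<Prod>w\<leftarrow>ws'. q w))"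
    by blast
  \<comment> \<open>The product of \<open>us\<close> preserves \<open>b\<close> and fixes
    \<open>s\<close>, so \<open>b ?x s = b e s\<close>.\<close>
  have "b (?x - e) s = 0" if "s \<in> S" for s
    using b_reflections[OF us, of e s] reflections_fixes[of us s] S(1) that
    by (simp add: b_simps)
  then have "\<forall>w\<in>set ws'. \<forall>s\<in>insert e S. b w s = 0"
    using ws'(2,3) S(2) by blast
  then have orth: "\<forall>w\<in>set (ws' @ ws). \<forall>s\<in>insert e S. b w s = 0"
    using ws(2) unfolding set_append by blast
  have "reflections (u # us) = (reflection u \<circ> reflection (?x - e)) \<circ> reflections ws"
    unfolding reflections_Cons comp_assoc ws(3)[symmetric] ..
  also have "\<dots> = reflection (reflections (u # us) e - e) \<circ> reflections (ws' @ ws)"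
    unfolding ws'(4) by (simp add: reflections_append comp_assoc)
  finally have exch: "reflections (u # us)
      = reflection (reflections (u # us) e - e) \<circ> reflections (ws' @ ws)" .
  have "square_class (\<Prod>u\<leftarrow>u # us. q u)
      = square_class (q u * reflection_norm (?x - e) * (\<Prod>w\<leftarrow>ws. q w))"
    using square_class_mult_cong[OF refl ws(4), of "q u"] by (simp add: mult.assoc)
  also have "\<dots> = square_class
      (reflection_norm (reflections (u # us) e - e) * (\<Prod>w\<leftarrow>ws' @ ws. q w))"
    using square_class_mult_cong[OF ws'(5) refl] by (simp add: mult.assoc)
  finally show ?case
    using ws(1) ws'(1) orth exch
    by (intro exI[of _ "ws' @ ws"] conjI) (simp_all only: set_append Un_iff simp_thms)
qed

section \<open>Well-definedness of the spinor norm\<close>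

lemma square_class_identity_reflections:
  assumes "reflections us = id" "0 \<notin> set us"
  shows "square_class (\<Prod>u\<leftarrow>us. q u) = square_class 1"
proof -
  \<comment> \<open>Generalized for induction: \<open>S\<close> contains the basis vectors already
    treated, \<open>bs\<close> those still to come.\<close>
  have *: "square_class (\<Prod>u\<leftarrow>us. q u) = square_class 1"
    if "reflections us = id" "0 \<notin> set us" "\<forall>u\<in>set us. \<forall>s\<in>S. b u s = 0"
      "span (S \<union> set bs) = UNIV" for bs S us
    using that
  proof (induction bs arbitrary: S us)
    case Nil
    \<comment> \<open>Once \<open>S\<close> spans the space, every remaining \<open>u\<close> is
      orthogonal to itself, which anisotropy forbids for nonzero \<open>u\<close>; so the list is
      empty.\<close>
    have "q u = 0" if "u \<in> set us" for u
      unfolding q_def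
    proof (rule b_eq_0_span)
      show "u \<in> span S"
        using Nil.prems(4) by simp
      show "b s u = 0" if "s \<in> S" for s
        using Nil.prems(3) \<open>u \<in> set us\<close> that by (subst symmetric) blast
    qed
    then have "us = []"
      using Nil.prems(2) by (cases us) auto
    then show ?case
      by simp
  next
    case (Cons e bs)
    obtain ws where ws: "0 \<notin> set ws" "\<forall>w\<in>set ws. \<forall>s\<in>insert e S. b w s = 0"
      "reflections us = reflection (reflections us e - e) \<circ> reflections ws"
      "square_class (\<Prod>u\<leftarrow>us. q u)
        = square_class (reflection_norm (reflections us e - e) * (\<Prod>w\<leftarrow>ws. q w))"
      using reflections_exchange[OF Cons.prems(2,3), of e] by blast
    \<comment> \<open>The identity does not move \<open>e\<close>, so the front factor is the
      reflection along 0 and disappears.\<close>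
    have "reflections ws = id"
      using ws(3) Cons.prems(1) by (simp add: fun_eq_iff)
    then have "square_class (\<Prod>w\<leftarrow>ws. q w) = square_class 1"
      using Cons.IH[OF _ ws(1,2)] Cons.prems(4) by simp
    then show ?case
      using ws(4) Cons.prems(1) by (simp add: reflection_norm_def)
  qed
  obtain bs where "ordered_basis bs"
    using ordered_basis_exists by blast
  then show ?thesis
    using *[of us "{}" bs] assms by (simp add: ordered_basis_def)
qed

text \<open>The list \<open>us @ rev vs\<close> represents the identity, so \<open>?U * ?V\<close>
  is in the class of 1; multiplying by \<open>?V\<close> changes the left side to \<open>?U\<close>
  times a square.\<close>

lemma square_class_reflections_unique:
  assumes eq: "reflections us = reflections vs" and us: "0 \<notin> set us" and vs: "0 \<notin> set vs"
  shows "square_class (\<Prod>u\<leftarrow>us. q u) = square_class (\<Prod>v\<leftarrow>vs. q v)"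
proof -
  let ?U = "\<Prod>u\<leftarrow>us. q u" and ?V = "\<Prod>v\<leftarrow>vs. q v"
  have "\<forall>v\<in>set vs. q v \<noteq> 0"
    using vs by auto
  then have "reflections (us @ rev vs) = id"
    using reflections_rev[of vs] by (simp add: reflections_append eq)
  then have "square_class (\<Prod>u\<leftarrow>us @ rev vs. q u) = square_class 1"
    using us vs by (intro square_class_identity_reflections) auto
  also have "(\<Prod>u\<leftarrow>us @ rev vs. q u) = ?U * ?V"
    by (simp add: rev_map[symmetric] prod_list.rev)
  finally have "square_class (?U * ?V * ?V) = square_class (1 * ?V)"
    by (rule square_class_mult_cong) simp
  moreover have "?V \<noteq> 0"
    using vs by (auto simp: prod_list_zero_iff)
  then have "square_class (?U * ?V * ?V) = square_class ?U"
    unfolding square_class_eq_iff by (intro exI[of _ ?V]) (simp add: power2_eq_square mult.assoc)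
  ultimately show ?thesis
    by simp
qed

lemma spinor_norm_reflections:
  assumes "0 \<notin> set us"
  shows "spinor_norm (reflections us) = square_class (\<Prod>u\<leftarrow>us. q u)"
proof -
  have iff: "reflection_factorization (reflections us) vs
      \<longleftrightarrow> 0 \<notin> set vs \<and> reflections us = reflections vs" for vs
    unfolding reflection_factorization_iff by auto
  show ?thesis
    unfolding spinor_norm_def iff
  proof (rule the_equality)
    show "\<exists>vs. (0 \<notin> set vs \<and> reflections us = reflections vs) \<and>
        square_class (\<Prod>u\<leftarrow>us. q u) = square_class (\<Prod>v\<leftarrow>vs. q v)"
      using assms by blast
  qed (use square_class_reflections_unique[OF _ assms] in blast)
qed

section \<open>The Cartan-Dieudonne theorem and rotations\<close>

text \<open>The reflection along \<open>\<sigma> e - e\<close> carries \<open>\<sigma> e\<close>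
  back to \<open>e\<close> and keeps every vector fixed by \<open>\<sigma>\<close>. Running
  \<open>e\<close> through a basis reduces \<open>\<sigma>\<close> to the identity; anisotropy makes
  each nonzero difference admissible.\<close>

lemma cartan_dieudonne:
  assumes "\<sigma> \<in> orthogonal_group"
  obtains us where "0 \<notin> set us" "\<sigma> = reflections us"
proof -
  have *: "\<exists>us. 0 \<notin> set us \<and> \<sigma> = reflections us"
    if "Vector_Spaces.linear scale scale \<sigma>" "\<And>x y. b (\<sigma> x) (\<sigma> y) = b x y"
      "\<forall>s\<in>S. \<sigma> s = s" "span (S \<union> set bs) = UNIV" for bs S \<sigma>
    using that
  proof (induction bs arbitrary: S \<sigma>)
    case Nil
    interpret \<sigma>: Vector_Spaces.linear scale scale \<sigma>
      by (rule Nil.prems(1))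
    have "\<sigma> x = x" for x
    proof -
      have "x \<in> span S"
        using Nil.prems(4) by simp
      then show ?thesis
        by (induction rule: span_induct_alt) (use Nil.prems(3) in \<open>simp_all add: \<sigma>.add \<sigma>.scale\<close>)
    qed
    then have "\<sigma> = reflections []"
      by (simp add: fun_eq_iff)
    then show ?case
      by (intro exI[of _ "[]"]) simp
  next
    case (Cons e bs)
    let ?a = "\<sigma> e - e"
    have b_refl: "b (reflection ?a x) (reflection ?a y) = b x y" for x y
      by (cases "?a = 0") (simp_all add: b_reflection)
    have refl_refl: "reflection ?a (reflection ?a x) = x" for x
      by (cases "?a = 0") (simp_all add: reflection_involution)
    let ?\<tau> = "reflection ?a \<circ> \<sigma>"
    have "?\<tau> s = s" if "s \<in> S" for s
    proof -
      have "b ?a s = b (\<sigma> e) (\<sigma> s) - b e s"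
        using Cons.prems(3) that by (simp add: b_simps)
      then have "b ?a s = 0"
        unfolding Cons.prems(2) by simp
      then show ?thesis
        using Cons.prems(3) that by (simp add: reflection_fixes)
    qed
    moreover have "?\<tau> e = e"
    proof (cases "?a = 0")
      case False
      \<comment> \<open>Because \<open>\<sigma> e\<close> and \<open>e\<close> have the same value,
        the coefficient in the reflection formula is exactly 1.\<close>
      have "q ?a = 2 * b (\<sigma> e) ?a"
        using Cons.prems(2)[of e e] by (simp add: q_def b_simps symmetric[of e "\<sigma> e"])
      then have "2 * b (\<sigma> e) ?a / q ?a = 1"
        using False q_eq_0_iff[of ?a] by simp
      then have "reflection ?a (\<sigma> e) = \<sigma> e - ?a"
        by (simp only: reflection_def scale_one)
      then show ?thesis
        by simp
    qed simp
    ultimately have "\<exists>us. 0 \<notin> set us \<and> ?\<tau> = reflections us"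
      using Cons.prems
      by (intro Cons.IH[of _ "insert e S"] Vector_Spaces.linear_compose[OF _ reflection_linear])
        (auto simp: b_refl)
    then obtain us where us: "0 \<notin> set us" "?\<tau> = reflections us"
      by blast
    have "\<sigma> = reflection ?a \<circ> reflections us"
      unfolding us(2)[symmetric] by (simp add: fun_eq_iff refl_refl)
    then show ?case
      using us(1) by (cases "?a = 0") (auto intro: exI[of _ us] exI[of _ "?a # us"])
  qed
  obtain bs where "ordered_basis bs"
    using ordered_basis_exists by blast
  then show thesis
    using *[of \<sigma> "{}" bs] assms that by (auto simp: ordered_basis_def orthogonal_group_def)
qed

text \<open>Each reflection contributes the factor -1 to the determinant, and -1 differs from 1
  because 2 is nonzero.\<close>

lemma special_orthogonal_group_iff:
  "\<sigma> \<in> special_orthogonal_group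
    \<longleftrightarrow> (\<exists>us. 0 \<notin> set us \<and> even (length us) \<and> \<sigma> = reflections us)"
proof
  assume "\<sigma> \<in> special_orthogonal_group"
  then have \<sigma>: "\<sigma> \<in> orthogonal_group" and det: "endo_det \<sigma> = 1"
    by (auto simp: special_orthogonal_group_def)
  obtain us where us: "0 \<notin> set us" "\<sigma> = reflections us"
    using cartan_dieudonne[OF \<sigma>] by blast
  have "\<forall>u\<in>set us. q u \<noteq> 0"
    using us(1) by auto
  then have pow: "(-1 :: 'f) ^ length us = 1"
    using det us(2) endo_det_reflections by simp
  have "even (length us)"
  proof (rule ccontr)
    assume "odd (length us)"
    then have "(-1 :: 'f) = 1"
      using pow by simp
    then have "(1 + 1 :: 'f) = 0"
      by (metis add.right_inverse)
    then show False
      by simp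
  qed
  then show "\<exists>us. 0 \<notin> set us \<and> even (length us) \<and> \<sigma> = reflections us"
    using us by blast
next
  assume "\<exists>us. 0 \<notin> set us \<and> even (length us) \<and> \<sigma> = reflections us"
  then obtain us where us: "0 \<notin> set us" "even (length us)" "\<sigma> = reflections us"
    by blast
  have "\<forall>u\<in>set us. q u \<noteq> 0"
    using us(1) by auto
  then show "\<sigma> \<in> special_orthogonal_group"
    using us by (simp add: special_orthogonal_group_def reflections_in_orthogonal_group
        endo_det_reflections)
qed

section \<open>Trivial spinor norm and a single square class\<close>

lemma square_class_q:
  assumes "\<forall>a. represents a \<longrightarrow> a \<in> square_class d" "x \<noteq> 0"
  shows "square_class (q x) = square_class d"
proof -
  have "q x \<in> square_class d"
    using assms by (auto simp: represents_def)
  then show ?thesis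
    unfolding square_class_eq_iff by (auto simp: square_class_def)
qed

lemma spinor_norm_trivial:
  assumes "represents_only_one_square_class" "\<sigma> \<in> special_orthogonal_group"
  shows "spinor_norm \<sigma> = square_class 1"
proof -
  obtain d where d: "d \<noteq> 0" "\<forall>a. represents a \<longrightarrow> a \<in> square_class d"
    using assms(1) by (auto simp: represents_only_one_square_class_def)
  obtain us where us: "0 \<notin> set us" "even (length us)" "\<sigma> = reflections us"
    using assms(2) by (auto simp: special_orthogonal_group_iff)
  have "square_class (\<Prod>u\<leftarrow>us. q u) = square_class (d ^ length us)"
    using us(1)
  proof (induction us)
    case (Cons u us)
    then show ?case
      using square_class_mult_cong[OF square_class_q[OF d(2)]] by simp
  qed simp
  also have "\<dots> = square_class 1"
  proof -
    obtain k where "length us = 2 * k"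
      using us(2) by blast
    then show ?thesis
      unfolding square_class_eq_iff using d(1)
      by (intro exI[of _ "d ^ k"]) (simp add: power_mult[symmetric] mult.commute)
  qed
  finally show ?thesis
    using spinor_norm_reflections[OF us(1)] us(3) by simp
qed

lemma spinor_norm_image_eq_iff:
  assumes "\<exists>x::'v. x \<noteq> 0"
  shows "spinor_norm ` special_orthogonal_group = {square_class 1}
    \<longleftrightarrow> represents_only_one_square_class"
proof
  assume trivial: "spinor_norm ` special_orthogonal_group = {square_class 1}"
  obtain u :: 'v where u: "u \<noteq> 0"
    using assms by blast
  have "q v \<in> square_class (q u)" if v: "v \<noteq> 0" for v
  proof -
    have "reflections [u, v] \<in> special_orthogonal_group"
      unfolding special_orthogonal_group_iff using u v by (intro exI[of _ "[u, v]"]) simp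
    then have "square_class (\<Prod>w\<leftarrow>[u, v]. q w) = square_class 1"
      using trivial spinor_norm_reflections[of "[u, v]"] u v by auto
    then obtain r where r: "r \<noteq> 0" "q u * q v = r ^ 2"
      unfolding square_class_eq_iff by auto
    have "q u * (r / q u) ^ 2 = r ^ 2 / q u"
      using u by (simp add: power_divide power2_eq_square)
    also have "\<dots> = q v"
      using u unfolding r(2)[symmetric] by simp
    finally have "q v = q u * (r / q u) ^ 2"
      by simp
    then show ?thesis
      unfolding square_class_def using r(1) u by (intro CollectI exI[of _ "r / q u"]) simp
  qed
  then show represents_only_one_square_class
    unfolding represents_only_one_square_class_def represents_def using u
    by (intro exI[of _ "q u"]) auto
next
  assume one: represents_only_one_square_class
  \<comment> \<open>The identity is a rotation, so the image is nonempty and really contains the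
    class of 1.\<close>
  have "reflections [] \<in> special_orthogonal_group"
    unfolding special_orthogonal_group_iff by (intro exI[of _ "[]"]) simp
  then show "spinor_norm ` special_orthogonal_group = {square_class 1}"
    using spinor_norm_trivial[OF one] by (intro antisym) (auto simp: image_iff)
qed

section \<open>Orthogonal bases of constant value and similarity\<close>

text \<open>For nonzero \<open>d\<close>, this is an orthonormal family for the form
  \<open>b\<close> divided by \<open>d\<close>.\<close>

definition orthogonal_family :: "'f \<Rightarrow> 'v set \<Rightarrow> bool" where
  "orthogonal_family d E \<longleftrightarrow> finite E \<and> (\<forall>e\<in>E. \<forall>f\<in>E. b e f = (if e = f then d else 0))"

text \<open>A Gram-Schmidt step: \<open>p\<close> is the orthogonal projection of \<open>v\<close>
  to the span of \<open>E\<close>. The single square class makes \<open>q (v - p)\<close> equal to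
  \<open>d * r ^ 2\<close>, so division by \<open>r\<close> normalizes the value to
  \<open>d\<close>.\<close>

lemma orthogonal_family_extend:
  assumes d: "d \<noteq> 0" "\<forall>a. represents a \<longrightarrow> a \<in> square_class d"
    and E: "orthogonal_family d E" "span E \<noteq> UNIV"
  obtains f where "f \<notin> span E" "orthogonal_family d (insert f E)"
proof -
  obtain v where v: "v \<notin> span E"
    using E(2) by blast
  define p where "p = (\<Sum>e\<in>E. scale (b v e / d) e)"
  have p: "p \<in> span E"
    unfolding p_def by (intro span_sum span_scale span_base)
  have w: "v - p \<notin> span E"
    using v p span_add[of "v - p" E p] by auto
  then have "v - p \<noteq> 0"
    using span_zero by metis
  then obtain r where r: "r \<noteq> 0" "q (v - p) = d * r ^ 2"
    using square_class_q[OF d(2)] unfolding square_class_eq_iff by blast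
  have fin: "finite E"
    using E(1) by (simp add: orthogonal_family_def)
  have orth: "b e (v - p) = 0" if "e \<in> E" for e
  proof -
    have "b e p = (\<Sum>f\<in>E. if e = f then b v e else 0)"
      unfolding p_def b_sum_right
      using E(1) that d(1) by (intro sum.cong) (auto simp: orthogonal_family_def b_simps)
    then show ?thesis
      using fin that by (simp add: b_simps symmetric[of e v])
  qed
  define f where "f = scale (1 / r) (v - p)"
  have "scale r f = v - p"
    using r(1) by (simp add: f_def)
  then have f: "f \<notin> span E"
    using w span_scale[of f E r] by auto
  have "b e f = 0" "b f e = 0" if "e \<in> E" for e
    using orth[OF that] by (simp_all add: f_def b_scale_left b_scale_right symmetric[of _ e])
  moreover have "b f f = d"
    using r q_scale[of "1 / r" "v - p"] by (simp add: f_def q_def[symmetric] power_divide)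
  moreover have "f \<notin> E"
    using f span_base by blast
  ultimately have "orthogonal_family d (insert f E)"
    using E(1) by (auto simp: orthogonal_family_def)
  then show thesis
    using f that by blast
qed

lemma orthogonal_basis_exists:
  assumes d: "d \<noteq> 0" "\<forall>a. represents a \<longrightarrow> a \<in> square_class d"
  obtains E where "orthogonal_family d E" "span E = UNIV" "card E = dim UNIV"
proof -
  have ex: "\<exists>E. orthogonal_family d E \<and> independent E \<and> card E = k" if "k \<le> dim UNIV" for k
    using that
  proof (induction k)
    case 0
    show ?case
      by (intro exI[of _ "{}"]) (simp add: orthogonal_family_def independent_empty)
  next
    case (Suc k)
    then obtain E where E: "orthogonal_family d E" "independent E" "card E = k"
      by auto
    have fin: "finite E"
      using E(1) by (simp add: orthogonal_family_def)
    have "span E \<noteq> UNIV"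
      using dim_le_card[of UNIV E] fin E(3) Suc.prems by auto
    then obtain f where f: "f \<notin> span E" "orthogonal_family d (insert f E)"
      using orthogonal_family_extend[OF d E(1)] by blast
    have "f \<notin> E"
      using f(1) span_base by blast
    then show ?case
      using f fin E(2,3) independent_insertI[OF f(1)] by (intro exI[of _ "insert f E"]) simp
  qed
  then obtain E where E: "orthogonal_family d E" "independent E" "card E = dim UNIV"
    by blast
  \<comment> \<open>Otherwise a further extension would be an independent set larger than the
    dimension.\<close>
  have "span E = UNIV"
  proof (rule ccontr)
    assume "span E \<noteq> UNIV"
    then obtain f where f: "f \<notin> span E" "orthogonal_family d (insert f E)"
      using orthogonal_family_extend[OF d E(1)] by blast
    obtain bs where bs: "ordered_basis bs"
      using ordered_basis_exists by blast
    have "card (set bs) = dim UNIV"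
      using bs by (intro basis_card_eq_dim) (auto simp: ordered_basis_def)
    then have "card (insert f E) \<le> dim UNIV"
      using independent_span_bound[of "set bs" "insert f E"] independent_insertI[OF f(1) E(2)] bs
      by (simp add: ordered_basis_def)
    moreover have "f \<notin> E"
      using f(1) span_base by blast
    ultimately show False
      using E(1,3) by (simp add: orthogonal_family_def)
  qed
  then show thesis
    using E that by blast
qed

lemma similar_to_sum_of_squares:
  assumes represents_only_one_square_class
  shows "similar_to_sum_of_squares (dim UNIV)"
proof -
  obtain d where d: "d \<noteq> 0" "\<forall>a. represents a \<longrightarrow> a \<in> square_class d"
    using assms by (auto simp: represents_only_one_square_class_def)
  obtain E where E: "orthogonal_family d E" "span E = UNIV" "card E = dim UNIV"
    using orthogonal_basis_exists[OF d] by blast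
  let ?n = "dim UNIV"
  obtain es where es: "set es = E" "distinct es"
    using E(1) finite_distinct_list[of E] unfolding orthogonal_family_def by blast
  have len: "length es = ?n"
    using es E(3) distinct_card by metis
  have b_es: "b (es ! i) (es ! j) = (if i = j then d else 0)" if "i < ?n" "j < ?n" for i j
    using E(1) es that len nth_eq_iff_index_eq[of es i j] nth_mem[of i es] nth_mem[of j es]
    by (simp add: orthogonal_family_def)
  \<comment> \<open>\<open>\<phi>\<close> reads off the coordinates in the orthogonal basis by
    pairing with its members; \<open>\<psi>\<close> is the inverse, forming the linear
    combination.\<close>
  define \<phi> where "\<phi> x = vec ?n (\<lambda>i. b x (es ! i) / d)" for x
  define \<psi> where "\<psi> v = (\<Sum>i<?n. scale (v $ i) (es ! i))" for v
  have b_\<psi>: "b (es ! j) (\<psi> v) = v $ j * d" if "j < ?n" for j v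
  proof -
    have "b (es ! j) (\<psi> v) = (\<Sum>i<?n. if i = j then v $ j * d else 0)"
      unfolding \<psi>_def b_sum_right using that by (intro sum.cong) (auto simp: b_simps b_es)
    then show ?thesis
      using that by simp
  qed
  have \<phi>\<psi>: "\<phi> (\<psi> v) = v" if "v \<in> carrier_vec ?n" for v
    using that d(1) by (intro eq_vecI) (auto simp: \<phi>_def b_\<psi> symmetric[of "\<psi> v"])
  have \<psi>\<phi>: "\<psi> (\<phi> x) = x" for x
  proof -
    \<comment> \<open>The difference is orthogonal to a spanning set, hence to itself, and vanishes
      by anisotropy.\<close>
    have "b s (x - \<psi> (\<phi> x)) = 0" if s: "s \<in> E" for s
    proof -
      obtain j where j: "j < ?n" "s = es ! j"
        using s es(1) len by (auto simp: in_set_conv_nth)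
      then show ?thesis
        using d(1) by (simp add: b_simps b_\<psi>) (simp add: \<phi>_def symmetric[of x "es ! j"])
    qed
    then have "b (x - \<psi> (\<phi> x)) (x - \<psi> (\<phi> x)) = 0"
      using b_eq_0_span[of "x - \<psi> (\<phi> x)" E] E(2) by blast
    then show ?thesis
      using q_eq_0_iff[of "x - \<psi> (\<phi> x)"] by (simp add: q_def)
  qed
  have "bij_betw \<phi> UNIV (carrier_vec ?n)"
    by (rule bij_betw_byWitness[where f' = \<psi>]) (auto simp: \<phi>\<psi> \<psi>\<phi>, simp add: \<phi>_def)
  moreover have "\<phi> (x + y) = \<phi> x + \<phi> y" "\<phi> (scale c x) = c \<cdot>\<^sub>v \<phi> x" for x y c
    by (auto simp: \<phi>_def b_simps add_divide_distrib intro!: eq_vecI)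
  moreover have "q x = d * (\<Sum>i<?n. (\<phi> x $ i) ^ 2)" for x
  proof -
    have "q x = b x (\<psi> (\<phi> x))"
      by (simp add: \<psi>\<phi> q_def)
    also have "\<dots> = (\<Sum>i<?n. d * (\<phi> x $ i) ^ 2)"
      unfolding \<psi>_def b_sum_right using d(1)
      by (intro sum.cong) (simp_all add: b_simps \<phi>_def power2_eq_square)
    finally show ?thesis
      by (simp add: sum_distrib_left)
  qed
  ultimately show ?thesis
    unfolding similar_to_sum_of_squares_def using d(1) by blast
qed

section \<open>Sums of squares in the field\<close>

lemma sum_of_two_squares:
  fixes x y :: 'f
  assumes represents_only_one_square_class "dim UNIV \<ge> 2" "x \<noteq> 0 \<or> y \<noteq> 0"
  obtains z where "z \<noteq> 0" "x ^ 2 + y ^ 2 = z ^ 2"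
proof -
  obtain d where d: "d \<noteq> 0" "\<forall>a. represents a \<longrightarrow> a \<in> square_class d"
    using assms(1) by (auto simp: represents_only_one_square_class_def)
  obtain E where E: "orthogonal_family d E" "card E = dim UNIV"
    using orthogonal_basis_exists[OF d] by blast
  have "\<not> (\<exists>e. E \<subseteq> {e})"
    using E(2) assms(2) card_mono[of "{e}" E for e] by fastforce
  then obtain e f where ef: "e \<in> E" "f \<in> E" "e \<noteq> f"
    by blast
  then have b_ef: "b e e = d" "b f f = d" "b e f = 0" "b f e = 0"
    using E(1) by (auto simp: orthogonal_family_def)
  let ?v = "scale x e + scale y f"
  have "b e ?v = x * d" "b f ?v = y * d"
    by (simp_all add: b_simps b_ef)
  \<comment> \<open>If \<open>?v\<close> were 0, its pairings \<open>x * d\<close> and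
    \<open>y * d\<close> with \<open>e\<close> and \<open>f\<close> would both vanish.\<close>
  then have "?v \<noteq> 0"
    using assms(3) d(1) b_zero_right[of e] b_zero_right[of f] mult_eq_0_iff[of _ d] by metis
  then obtain z where "z \<noteq> 0" "q ?v = d * z ^ 2"
    using square_class_q[OF d(2)] unfolding square_class_eq_iff by blast
  moreover have "q ?v = d * (x ^ 2 + y ^ 2)"
    by (simp add: q_def b_simps b_ef power2_eq_square algebra_simps)
  ultimately show thesis
    using d(1) that by simp
qed

lemma pythagorean_if_one_square_class:
  assumes represents_only_one_square_class "dim UNIV \<ge> 2"
  shows "pythagorean TYPE('f)"
proof -
  have "\<exists>c. (\<Sum>x\<leftarrow>xs. x ^ 2) = c ^ 2" for xs :: "'f list"
  proof (induction xs)
    case Nil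
    show ?case
      by (intro exI[of _ 0]) simp
  next
    case (Cons x xs)
    then obtain c where c: "(\<Sum>x\<leftarrow>xs. x ^ 2) = c ^ 2"
      by blast
    show ?case
    \<comment> \<open>The split keeps the pair \<open>x\<close>, \<open>c\<close> from being zero in
      both entries, as \<open>sum_of_two_squares\<close> requires.\<close>
    proof (cases "x = 0")
      case True
      then show ?thesis
        using c by (intro exI[of _ c]) simp
    next
      case False
      then obtain z where "x ^ 2 + c ^ 2 = z ^ 2"
        using sum_of_two_squares[OF assms, of x c] by blast
      then show ?thesis
        using c by (intro exI[of _ z]) simp
    qed
  qed
  then show ?thesis
    by (auto simp: pythagorean_def sum_of_squares_def)
qed

text \<open>If -1 were a sum of squares, it would be a square \<open>c ^ 2\<close>, and then
  \<open>1 + c ^ 2 = 0\<close> would have to be the square of a nonzero element.\<close>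

lemma formally_real_if_one_square_class:
  assumes represents_only_one_square_class "dim UNIV \<ge> 2"
  shows "formally_real TYPE('f)"
  unfolding formally_real_def
proof
  assume "sum_of_squares (-1 :: 'f)"
  then obtain c :: 'f where c: "-1 = c ^ 2"
    using pythagorean_if_one_square_class[OF assms] by (auto simp: pythagorean_def)
  obtain z :: 'f where "z \<noteq> 0" "1 ^ 2 + c ^ 2 = z ^ 2"
    using sum_of_two_squares[OF assms, of 1 c] by auto
  then show False
    unfolding c[symmetric] by simp
qed

end

theorem proposition3p1:
  fixes scale :: "'f::field \<Rightarrow> 'v::ab_group_add \<Rightarrow> 'v"
    and b :: "'v \<Rightarrow> 'v \<Rightarrow> 'f"
    and n :: nat
  assumes "CHAR('f) \<noteq> 2"
    and "bilinear_space scale b"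
    and "bilinear_space.anisotropic b"
    and "vector_space.dim scale UNIV = n"
    and "n \<ge> 2"
  shows "(bilinear_space.spinor_norm scale b ` bilinear_space.special_orthogonal_group scale b
            = {square_class 1} \<longleftrightarrow>
          formally_real TYPE('f) \<and> pythagorean TYPE('f) \<and>
          bilinear_space.represents_only_one_square_class b) \<and>
         (bilinear_space.spinor_norm scale b ` bilinear_space.special_orthogonal_group scale b
            = {square_class 1} \<longrightarrow>
          bilinear_space.similar_to_sum_of_squares scale b n)"
proof -
  interpret anisotropic_bilinear_space scale b
    using assms(1-3)
    by (intro anisotropic_bilinear_space.intro anisotropic_bilinear_space_axioms.intro)
  have dim: "dim UNIV \<ge> 2"
    using assms(4,5) by simp
  have "\<exists>x::'v. x \<noteq> 0"
  proof (rule ccontr)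
    assume "\<not> (\<exists>x::'v. x \<noteq> 0)"
    then have "UNIV \<subseteq> span ({} :: 'v set)"
      by auto
    then show False
      using dim_le_card[of UNIV "{}"] dim by simp
  qed
  \<comment> \<open>Triviality of the image amounts to a single square class, from which both field
    properties and the similarity are derived.\<close>
  then show ?thesis
    using spinor_norm_image_eq_iff pythagorean_if_one_square_class[OF _ dim]
      formally_real_if_one_square_class[OF _ dim] similar_to_sum_of_squares assms(4)
    by blast
qed

end
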